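(* Let $a>0$ and $b\in\mathbb R$ with $b^2>(a+1)^2$, and consider the real curve $C=\{(x,y)\in\mathbb R^2:\ x^2y^2+a(x^2+y^2)+2bxy+1=0\}$. Let $k\in(0,1)$ be defined by $k+k^{-1}=(b^2-a^2-1)/a$, put $k'=\sqrt{1-k^2}$, $K'=\int_0^1\frac{dt}{\sqrt{(1-k'^2t^2)(1-t^2)}}$, and let $\theta$ be the minimal positive solution of $\mathrm{sc}(\theta,k')=1/\sqrt{ak}$. Then the John mapping $T:C\to C$ has a periodic point if and only if $$\frac{\theta}{K'}\in\mathbb Q .$$ In this case, writing $\theta/K'=m/n$ as an irreducible fraction, all points of $C$ are periodic with the same minimal period $n$, and $m$ is the number of full turns along the curve that the mapping $T^n$ performs.
   Context: $\mathrm{sc}=\mathrm{sn}/\mathrm{cn}$ is the Jacobi elliptic function; the second argument is the modulus. John mapping: for $M\in C$, $I_1M$ is the second intersection point of $C$ with the vertical line through $M$ and $I_2M$ is the second intersection point of $C$ with the horizontal line through $M$ (with $I_jM=M$ if the line touches $C$ at $M$); $T=I_2I_1$. A point $M$ is periodic if $T^nM=M$ for some $n\ge1$; the smallest such $n$ is its period. The curve consists of two bounded ovals; each is parameterized, with the parameter $\tau$ taken modulo $2K'$, by $x=\sqrt k\,\mathrm{sn}(\pm K+i\tau;k)$, $y=\sqrt k\,\mathrm{sn}(\pm K+i\tau+\eta;k)$ where $1+ka\,\mathrm{sn}^2(\eta;k)=0$, $K=\int_0^1\frac{dt}{\sqrt{(1-k^2t^2)(1-t^2)}}$; one full turn of an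 oval corresponds to an increase of $\tau$ by $2K'$ in absolute value. *)

theory Defs
  imports "HOL-Analysis.Analysis"
begin

section \<open>Jacobi elliptic functions\<close>

text \<open>The last argument is always the modulus \<open>k\<close> with \<open>0 < k < 1\<close>, not the parameter \<open>k\<^sup>2\<close>.\<close>

definition ellK :: "real \<Rightarrow> real" where
  "ellK k = (LBINT t=0..1. 1 / sqrt ((1 - k\<^sup>2 * t\<^sup>2) * (1 - t\<^sup>2)))"

definition ellF :: "real \<Rightarrow> real \<Rightarrow> real" where
  "ellF \<phi> k = (LBINT t=0..\<phi>. 1 / sqrt (1 - k\<^sup>2 * (sin t)\<^sup>2))"

text \<open>For \<open>0 < k < 1\<close> the map \<open>\<lambda>\<phi>. ellF \<phi> k\<close> is an increasing bijection of the real line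
  (the integral is oriented, so negative \<open>\<phi>\<close> are covered); the amplitude is its inverse.\<close>

definition jacobi_am :: "real \<Rightarrow> real \<Rightarrow> real" where
  "jacobi_am u k = (THE \<phi>. ellF \<phi> k = u)"

definition jacobi_sn :: "real \<Rightarrow> real \<Rightarrow> real" where
  "jacobi_sn u k = sin (jacobi_am u k)"

definition jacobi_cn :: "real \<Rightarrow> real \<Rightarrow> real" where
  "jacobi_cn u k = cos (jacobi_am u k)"

definition jacobi_dn :: "real \<Rightarrow> real \<Rightarrow> real" where
  "jacobi_dn u k = sqrt (1 - k\<^sup>2 * (jacobi_sn u k)\<^sup>2)"

definition jacobi_sc :: "real \<Rightarrow> real \<Rightarrow> real" where
  "jacobi_sc u k = jacobi_sn u k / jacobi_cn u k"

definition comp_modulus :: "real \<Rightarrow> real" where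
  "comp_modulus k = sqrt (1 - k\<^sup>2)"

text \<open>The extension of \<open>sn\<close> to \<open>z = u + iv\<close>: on the imaginary axis one has Jacobi's transformation
  \<open>sn(iv,k) = i sn(v,k')/cn(v,k')\<close>, \<open>cn(iv,k) = 1/cn(v,k')\<close>, \<open>dn(iv,k) = dn(v,k')/cn(v,k')\<close>, and the
  addition theorem then gives \<open>sn(u + iv,k)\<close>. Numerator and denominator are multiplied by
  \<open>cn(v,k')\<^sup>2\<close>, so that the removable singularities at \<open>cn(v,k') = 0\<close> disappear: the
  denominator vanishes exactly at the poles of \<open>sn\<close> (where the value is 0 by convention).\<close>

definition complex_sn :: "complex \<Rightarrow> real \<Rightarrow> complex" where
  "complex_sn z k =
     (let s = jacobi_sn (Re z) k; c = jacobi_cn (Re z) k; d = jacobi_dn (Re z) k;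
          s' = jacobi_sn (Im z) (comp_modulus k); c' = jacobi_cn (Im z) (comp_modulus k);
          d' = jacobi_dn (Im z) (comp_modulus k)
      in Complex (s * d') (c * d * s' * c') / of_real (c'\<^sup>2 + k\<^sup>2 * s\<^sup>2 * s'\<^sup>2))"


section \<open>The curve and the John mapping\<close>

definition curve :: "real \<Rightarrow> real \<Rightarrow> (real \<times> real) set" where
  "curve a b = {(x, y). x\<^sup>2 * y\<^sup>2 + a * (x\<^sup>2 + y\<^sup>2) + 2 * b * x * y + 1 = 0}"

text \<open>For \<open>a > 0\<close> the equation of the curve is quadratic in each variable separately, so a vertical
  or horizontal line through \<open>M \<in> C\<close> meets \<open>C\<close> in at most one further point, and in no further
  point precisely when the line touches \<open>C\<close> at \<open>M\<close>.\<close>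

definition vertical_switch :: "(real \<times> real) set \<Rightarrow> real \<times> real \<Rightarrow> real \<times> real" where
  "vertical_switch C M =
     (if \<exists>N\<in>C. N \<noteq> M \<and> fst N = fst M then THE N. N \<in> C \<and> N \<noteq> M \<and> fst N = fst M else M)"

definition horizontal_switch :: "(real \<times> real) set \<Rightarrow> real \<times> real \<Rightarrow> real \<times> real" where
  "horizontal_switch C M =
     (if \<exists>N\<in>C. N \<noteq> M \<and> snd N = snd M then THE N. N \<in> C \<and> N \<noteq> M \<and> snd N = snd M else M)"

definition john_map :: "(real \<times> real) set \<Rightarrow> real \<times> real \<Rightarrow> real \<times> real" where
  "john_map C = horizontal_switch C \<circ> vertical_switch C"

definition periodic_point :: "('a \<Rightarrow> 'a) \<Rightarrow> 'a \<Rightarrow> bool" where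
  "periodic_point f M \<longleftrightarrow> (\<exists>n\<ge>1. (f ^^ n) M = M)"

definition min_period :: "('a \<Rightarrow> 'a) \<Rightarrow> 'a \<Rightarrow> nat" where
  "min_period f M = (LEAST n. n \<ge> 1 \<and> (f ^^ n) M = M)"


section \<open>Parameterization of the ovals and counting of turns\<close>

text \<open>\<open>oval_param a b k \<epsilon> \<eta> \<gamma>\<close>: the path \<open>\<gamma>\<close> is the parameterization
  \<open>x = \<surd>k sn(\<epsilon>K + i\<tau>)\<close>, \<open>y = \<surd>k sn(\<epsilon>K + i\<tau> + \<eta>)\<close> of an oval of the real curve, where
  \<open>\<epsilon> = \<plusminus>1\<close> and \<open>1 + ka sn\<^sup>2\<eta> = 0\<close>. The last equation only fixes \<open>\<eta>\<close> up to sign and up to adding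
  multiples of \<open>2K\<close> and \<open>2iK'\<close>. Adding \<open>2K\<close> changes the sign of \<open>y\<close>, that is, replaces \<open>b\<close> by \<open>-b\<close>;
  the right choice is forced by \<open>\<gamma> \<tau> \<in> curve a b\<close>. Since \<open>2iK'\<close> is a period of \<open>sn\<close>, the
  representative with \<open>\<bar>Im \<eta>\<bar> < K'\<close> is taken.\<close>

definition oval_param ::
    "real \<Rightarrow> real \<Rightarrow> real \<Rightarrow> real \<Rightarrow> complex \<Rightarrow> (real \<Rightarrow> real \<times> real) \<Rightarrow> bool" where
  "oval_param a b k \<epsilon> \<eta> \<gamma> \<longleftrightarrow>
     \<epsilon> \<in> {1, -1} \<and>
     1 + of_real (k * a) * (complex_sn \<eta> k)\<^sup>2 = 0 \<and> \<bar>Im \<eta>\<bar> < ellK (comp_modulus k) \<and>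
     (\<forall>\<tau>. \<gamma> \<tau> \<in> curve a b \<and>
          complex_of_real (fst (\<gamma> \<tau>)) =
            of_real (sqrt k) * complex_sn (of_real (\<epsilon> * ellK k) + \<i> * of_real \<tau>) k \<and>
          complex_of_real (snd (\<gamma> \<tau>)) =
            of_real (sqrt k) * complex_sn (of_real (\<epsilon> * ellK k) + \<i> * of_real \<tau> + \<eta>) k)"

text \<open>The amount by which the parameter changes when one travels along the closed path \<open>\<gamma>\<close> from
  \<open>M\<close>, in the direction \<open>\<sigma> = \<plusminus>1\<close> of the parameter, until one first reaches \<open>f M\<close>.\<close>

definition travel :: "(real \<Rightarrow> 'a) \<Rightarrow> real \<Rightarrow> ('a \<Rightarrow> 'a) \<Rightarrow> 'a \<Rightarrow> real" where
  "travel \<gamma> \<sigma> f M = Inf {d. d \<ge> 0 \<and> (\<exists>\<tau>. \<gamma> \<tau> = M \<and> \<gamma> (\<tau> + \<sigma> * d) = f M)}"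

text \<open>The number of turns made on the way \<open>M, f M, f (f M), \<dots>, (f ^^ n) M\<close> if the parameter period
  of \<open>\<gamma>\<close> is \<open>P\<close>.\<close>

definition turns :: "(real \<Rightarrow> 'a) \<Rightarrow> real \<Rightarrow> real \<Rightarrow> ('a \<Rightarrow> 'a) \<Rightarrow> nat \<Rightarrow> 'a \<Rightarrow> real" where
  "turns \<gamma> P \<sigma> f n M = (\<Sum>j<n. travel \<gamma> \<sigma> f ((f ^^ j) M)) / P"

text \<open>Vertical lines pair \<open>\<tau>\<close> with \<open>-\<tau>\<close>, and horizontal lines pair \<open>\<tau>\<close> with \<open>-\<tau> - 2 Im \<eta>\<close>. Hence
  the John mapping moves the parameter by \<open>-2 Im \<eta>\<close>, which is less than one turn, and the turns
  are counted in the direction \<open>-sgn (Im \<eta>)\<close> of this motion. (Counted in the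
  opposite direction, every step that is not trivial would be replaced by its complement to a full
  turn.)\<close>

definition john_turns ::
    "real \<Rightarrow> real \<Rightarrow> real \<Rightarrow> complex \<Rightarrow> (real \<Rightarrow> real \<times> real) \<Rightarrow> nat \<Rightarrow> real \<times> real \<Rightarrow> real" where
  "john_turns a b k \<eta> \<gamma> n M =
     turns \<gamma> (2 * ellK (comp_modulus k)) (- sgn (Im \<eta>)) (john_map (curve a b)) n M"

end

theory Submission imports Defs begin

text \<open>Since \<open>sn(\<plusminus>K + i\<tau>, k) = \<plusminus>1 / dn(\<tau>, k')\<close>, each oval is
  \<open>(x, y) = (\<plusminus>\<surd>k / dn \<tau>, \<minusplus>sgn b \<surd>k / dn (\<tau> + v))\<close> with modulus \<open>k'\<close> and
  \<open>v = Im \<eta> = \<plusminus>\<theta>\<close>; that these points satisfy the curve equation is the addition theorem for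
  \<open>dn\<close>. As \<open>dn\<close> is even with period \<open>2K'\<close> and otherwise injective, the vertical switch is
  \<open>\<tau> \<mapsto> -\<tau>\<close> and the horizontal one \<open>\<tau> \<mapsto> -\<tau> - 2v\<close>, so \<open>T\<close> is the rotation
  \<open>\<tau> \<mapsto> \<tau> - 2v\<close> of \<open>\<real> / 2K'\<int>\<close>.\<close>

section \<open>The elliptic integral and the amplitude\<close>

context
  fixes k :: real
  assumes k: "0 < k" "k < 1"
begin

lemma k_sin_less_1: "k\<^sup>2 * (sin t)\<^sup>2 < 1"
proof -
  have "k\<^sup>2 < 1" using k by (simp add: power_less_one_iff)
  moreover have "(sin t)\<^sup>2 \<le> 1" by (simp add: abs_square_le_1)
  ultimately show ?thesis
    by (smt (verit) mult_left_le zero_le_power2)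
qed

lemma ellF_DERIV: "((\<lambda>\<phi>. ellF \<phi> k) has_real_derivative 1 / sqrt (1 - k\<^sup>2 * (sin \<phi>)\<^sup>2)) (at \<phi>)"
proof -
  let ?h = "\<lambda>t. 1 / sqrt (1 - k\<^sup>2 * (sin t)\<^sup>2)"
  \<comment> \<open>The interval [-r, r] contains the base point 0 and has \<phi> in its interior,
    so the derivative within the interval is a full derivative.\<close>
  define r where "r = \<bar>\<phi>\<bar> + 1"
  have cont: "continuous_on {-r..r} ?h"
    by (intro continuous_intros ballI) (use k_sin_less_1 in \<open>auto simp: algebra_simps, smt\<close>)
  have "((\<lambda>u. LBINT y=0..u. ?h y) has_vector_derivative ?h \<phi>) (at \<phi> within {-r..r})"
    using interval_integral_FTC2[of "-r" 0 r ?h \<phi>, OF _ _ cont]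
    by (simp add: r_def zero_ereal_def abs_if split: if_splits)
  moreover have "at \<phi> within {-r..r} = at \<phi>"
    by (rule at_within_Icc_at) (auto simp: r_def)
  ultimately show ?thesis
    by (simp add: ellF_def has_real_derivative_iff_has_vector_derivative)
qed

lemma ellF_0 [simp]: "ellF 0 k = 0"
  by (simp add: ellF_def zero_ereal_def)

lemma ellF_deriv_ge_1: "1 / sqrt (1 - k\<^sup>2 * (sin t)\<^sup>2) \<ge> 1"
  using k_sin_less_1[of t] by (simp add: field_simps)

lemma ellF_strict_mono: "strict_mono (\<lambda>\<phi>. ellF \<phi> k)"
proof (rule strict_monoI)
  fix x y :: real assume "x < y"
  then show "ellF x k < ellF y k"
    by (rule DERIV_pos_imp_increasing) (blast intro: ellF_DERIV less_le_trans[OF zero_less_one ellF_deriv_ge_1])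
qed

lemma ellF_continuous: "continuous_on UNIV (\<lambda>\<phi>. ellF \<phi> k)"
  by (intro continuous_at_imp_continuous_on ballI) (rule DERIV_isCont[OF ellF_DERIV])

text \<open>The integrand is at least 1. Comparison with the value at 0 shows that
  \<open>ellF\<close> grows at least linearly in both directions, which gives surjectivity.\<close>

lemma ellF_shift_mono:
  assumes "x \<le> y"
  shows "ellF x k - x \<le> ellF y k - y"
proof (rule DERIV_nonneg_imp_nondecreasing[OF assms])
  fix t
  show "\<exists>y. ((\<lambda>a. ellF a k - a) has_real_derivative y) (at t) \<and> 0 \<le> y"
    by (rule exI[of _ "1 / sqrt (1 - k\<^sup>2 * (sin t)\<^sup>2) - 1"])
       (use ellF_deriv_ge_1[of t] in \<open>auto intro!: derivative_eq_intros ellF_DERIV\<close>)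
qed

lemma ellF_surj: "\<exists>\<phi>. ellF \<phi> k = u"
proof -
  have "ellF (-\<bar>u\<bar>) k \<le> u" "u \<le> ellF \<bar>u\<bar> k"
    using ellF_shift_mono[of "-\<bar>u\<bar>" 0] ellF_shift_mono[of 0 "\<bar>u\<bar>"] by auto
  then show ?thesis
    using IVT'[of "\<lambda>\<phi>. ellF \<phi> k" "-\<bar>u\<bar>" u "\<bar>u\<bar>"] continuous_on_subset[OF ellF_continuous] by auto
qed

lemma ellF_eq_iff: "ellF x k = ellF y k \<longleftrightarrow> x = y"
  using ellF_strict_mono strict_mono_eq by blast

lemma ellF_jacobi_am [simp]: "ellF (jacobi_am u k) k = u"
  unfolding jacobi_am_def
  by (rule theI') (use ellF_surj ellF_eq_iff in metis)

lemma jacobi_am_ellF [simp]: "jacobi_am (ellF \<phi> k) k = \<phi>"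
  by (simp add: ellF_eq_iff flip: ellF_eq_iff)

lemma ellF_minus: "ellF (- \<phi>) k = - ellF \<phi> k"
proof -
  have "((\<lambda>t. ellF (- t) k + ellF t k) has_real_derivative 0) (at t)" for t
    by (rule derivative_eq_intros DERIV_chain2[OF ellF_DERIV] ellF_DERIV refl)+ simp
  from DERIV_isconst_all[OF allI[OF this], of \<phi> 0] show ?thesis by simp
qed

lemma ellF_add_pi: "ellF (\<phi> + pi) k = ellF \<phi> k + 2 * ellF (pi / 2) k"
proof -
  have "((\<lambda>t. ellF (t + pi) k - ellF t k) has_real_derivative 0) (at t)" for t
    by (rule derivative_eq_intros DERIV_chain2[OF ellF_DERIV] ellF_DERIV refl)+ simp
  \<comment> \<open>At \<open>- pi / 2\<close> the constant is the difference of the values at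
    \<open>pi / 2\<close> and \<open>- pi / 2\<close>, which oddness turns into twice the quarter
    value.\<close>
  from DERIV_isconst_all[OF allI[OF this], of \<phi> "- pi / 2"] show ?thesis
    using ellF_minus[of "pi / 2"] by simp
qed

text \<open>The substitution t = sin \<phi> makes \<open>ellF (arcsin t) k\<close> an antiderivative
  of the integrand of \<open>ellK\<close>. This integrand is singular at 1, hence the fundamental
  theorem for nonnegative integrands with one-sided limits at the endpoints.\<close>

lemma ellF_pi_half: "ellF (pi / 2) k = ellK k"
proof -
  let ?f = "\<lambda>t. 1 / sqrt ((1 - k\<^sup>2 * t\<^sup>2) * (1 - t\<^sup>2))"
  let ?F = "\<lambda>t. ellF (arcsin t) k"
  have pos: "(1 - k\<^sup>2 * t\<^sup>2) * (1 - t\<^sup>2) > 0" if "0 < t" "t < 1" for t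
    using that k_sin_less_1[of "arcsin t"]
    by (simp add: power_less_one_iff)
  have cont: "continuous_on {0..1} ?F"
    by (rule continuous_on_compose2[OF ellF_continuous]) (auto intro!: continuous_intros)
  have "(LBINT t=0..1. ?f t) = ellF (pi / 2) k - 0"
  proof (rule interval_integral_FTC_nonneg)
    fix t :: real assume "0 < ereal t" "ereal t < 1"
    then have t: "0 < t" "t < 1" by (auto simp: zero_ereal_def one_ereal_def)
    show "(?F has_real_derivative ?f t) (at t)"
      by (rule DERIV_cong[OF DERIV_chain2[OF ellF_DERIV DERIV_arcsin]])
         (use t in \<open>auto simp: real_sqrt_mult divide_inverse mult.commute\<close>)
    show "isCont ?f t"
      using pos[OF t] by (intro continuous_intros) auto
  next
    show "AE t in lborel. 0 < ereal t \<longrightarrow> ereal t < 1 \<longrightarrow> 0 \<le> ?f t"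
      using pos by (auto simp: zero_ereal_def one_ereal_def less_imp_le)
  next
    have "(?F \<longlongrightarrow> ?F 0) (at_right 0)"
      using cont by (rule continuous_on_Icc_at_rightD) simp
    then show "((?F \<circ> real_of_ereal) \<longlongrightarrow> 0) (at_right 0)"
      by (simp add: zero_ereal_def ereal_tendsto_simps ellF_0)
    have "(?F \<longlongrightarrow> ?F 1) (at_left 1)"
      using cont by (rule continuous_on_Icc_at_leftD) simp
    then show "((?F \<circ> real_of_ereal) \<longlongrightarrow> ellF (pi / 2) k) (at_left 1)"
      by (simp add: one_ereal_def ereal_tendsto_simps)
  qed auto
  then show ?thesis by (simp add: ellK_def)
qed

lemma ellK_pos: "ellK k > 0"
  using ellF_strict_mono[THEN strict_monoD, of 0 "pi / 2"] by (simp add: ellF_pi_half)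

lemma jacobi_am_eq_iff: "jacobi_am u k = \<phi> \<longleftrightarrow> u = ellF \<phi> k"
  by auto

lemma jacobi_am_less_iff: "jacobi_am u k < \<phi> \<longleftrightarrow> u < ellF \<phi> k"
  using ellF_strict_mono[THEN strict_mono_less, of "jacobi_am u k" \<phi>] by simp

lemma less_jacobi_am_iff: "\<phi> < jacobi_am u k \<longleftrightarrow> ellF \<phi> k < u"
  using ellF_strict_mono[THEN strict_mono_less, of \<phi> "jacobi_am u k"] by simp

lemma ellF_add_int_pi: "ellF (\<phi> + of_int j * pi) k = ellF \<phi> k + 2 * ellK k * of_int j"
proof (induction j rule: int_induct[where k=0])
  case (step1 i)
  then show ?case
    using ellF_add_pi[of "\<phi> + of_int i * pi"] by (simp add: algebra_simps ellF_pi_half)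
next
  case (step2 i)
  then show ?case
    using ellF_add_pi[of "\<phi> + of_int (i - 1) * pi"] by (simp add: algebra_simps ellF_pi_half)
qed simp

lemma jacobi_am_add: "jacobi_am (u + 2 * ellK k * of_int j) k = jacobi_am u k + of_int j * pi"
  by (simp add: jacobi_am_eq_iff ellF_add_int_pi)

lemma jacobi_am_minus: "jacobi_am (- u) k = - jacobi_am u k"
  by (simp add: jacobi_am_eq_iff ellF_minus)

lemma jacobi_am_0 [simp]: "jacobi_am 0 k = 0"
  by (simp add: jacobi_am_eq_iff)

lemma jacobi_am_ellK: "jacobi_am (ellK k) k = pi / 2"
  unfolding jacobi_am_eq_iff by (simp add: ellF_pi_half)

section \<open>Jacobi functions and the addition theorem\<close>

lemma jacobi_dn_pos: "jacobi_dn u k > 0"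
  using k_sin_less_1 by (simp add: jacobi_dn_def jacobi_sn_def)

lemma jacobi_dn_sq: "(jacobi_dn u k)\<^sup>2 = 1 - k\<^sup>2 * (jacobi_sn u k)\<^sup>2"
  using k_sin_less_1[of "jacobi_am u k"] by (simp add: jacobi_dn_def jacobi_sn_def)

lemma jacobi_cn_sq: "(jacobi_cn u k)\<^sup>2 = 1 - (jacobi_sn u k)\<^sup>2"
  by (simp add: jacobi_cn_def jacobi_sn_def cos_squared_eq)

lemma jacobi_am_DERIV: "((\<lambda>u. jacobi_am u k) has_real_derivative jacobi_dn u k) (at u)"
proof -
  let ?D = "1 / sqrt (1 - k\<^sup>2 * (sin (jacobi_am u k))\<^sup>2)"
  have "isCont (\<lambda>u. jacobi_am u k) (ellF (jacobi_am u k) k)"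
    by (rule isCont_inverse_function[where d = 1])
       (auto intro: DERIV_isCont[OF ellF_DERIV])
  then have cont: "isCont (\<lambda>u. jacobi_am u k) u" by simp
  have "((\<lambda>u. jacobi_am u k) has_real_derivative inverse ?D) (at u)"
  proof (rule DERIV_inverse_function[where a = "u - 1" and b = "u + 1" and f = "\<lambda>\<phi>. ellF \<phi> k"])
    show "?D \<noteq> 0" using ellF_deriv_ge_1[of "jacobi_am u k"] by linarith
  qed (auto intro: ellF_DERIV cont)
  then show ?thesis by (simp add: jacobi_dn_def jacobi_sn_def)
qed

lemma jacobi_sn_DERIV:
  "((\<lambda>u. jacobi_sn u k) has_real_derivative jacobi_cn u k * jacobi_dn u k) (at u)"
  unfolding jacobi_sn_def[abs_def] jacobi_cn_def
  by (rule DERIV_fun_sin jacobi_am_DERIV)+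

lemma jacobi_cn_DERIV:
  "((\<lambda>u. jacobi_cn u k) has_real_derivative - (jacobi_sn u k * jacobi_dn u k)) (at u)"
  unfolding jacobi_sn_def jacobi_cn_def[abs_def]
  by (auto intro!: derivative_eq_intros jacobi_am_DERIV)

lemma jacobi_dn_DERIV:
  "((\<lambda>u. jacobi_dn u k) has_real_derivative - (k\<^sup>2 * jacobi_sn u k * jacobi_cn u k)) (at u)"
proof -
  have *: "1 - k\<^sup>2 * (jacobi_sn u k)\<^sup>2 > 0"
    using jacobi_dn_pos[of u] jacobi_dn_sq[of u] by (metis zero_less_power)
  have "((\<lambda>u. 1 - k\<^sup>2 * (jacobi_sn u k)\<^sup>2) has_real_derivative
      - (2 * k\<^sup>2 * jacobi_sn u k * jacobi_cn u k * jacobi_dn u k)) (at u)"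
    by (rule derivative_eq_intros jacobi_sn_DERIV refl)+ simp
  from DERIV_chain2[where f = sqrt, OF DERIV_real_sqrt[OF *] this] show ?thesis
    unfolding jacobi_dn_def[symmetric]
    by (rule DERIV_cong) (use jacobi_dn_pos[of u] in \<open>simp add: field_simps\<close>)
qed

text \<open>Keeps the denominator of the addition theorem positive.\<close>

lemma k_sn_sn_less_1: "k\<^sup>2 * (jacobi_sn u k)\<^sup>2 * (jacobi_sn v k)\<^sup>2 < 1"
proof -
  have "k\<^sup>2 * (jacobi_sn u k)\<^sup>2 * (jacobi_sn v k)\<^sup>2 \<le> k\<^sup>2 * (jacobi_sn u k)\<^sup>2 * 1"
    by (intro mult_left_mono) (auto simp: jacobi_sn_def abs_square_le_1)
  also have "\<dots> < 1" using k_sin_less_1 by (simp add: jacobi_sn_def)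
  finally show ?thesis .
qed

text \<open>With \<open>u + v = w\<close> held fixed, the right-hand side has derivative zero in \<open>u\<close>.\<close>

lemma jacobi_dn_add:
  "jacobi_dn (u + v) k =
    (jacobi_dn u k * jacobi_dn v k
      - k\<^sup>2 * jacobi_sn u k * jacobi_cn u k * jacobi_sn v k * jacobi_cn v k) /
    (1 - k\<^sup>2 * (jacobi_sn u k)\<^sup>2 * (jacobi_sn v k)\<^sup>2)"
proof -
  define w where "w = u + v"
  define N where "N t = jacobi_dn t k * jacobi_dn (w - t) k
      - k\<^sup>2 * jacobi_sn t k * jacobi_cn t k * jacobi_sn (w - t) k * jacobi_cn (w - t) k" for t
  define Q where "Q t = 1 - k\<^sup>2 * (jacobi_sn t k)\<^sup>2 * (jacobi_sn (w - t) k)\<^sup>2" for t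
  have "((\<lambda>t. N t / Q t) has_real_derivative 0) (at t)" for t
  proof -
    define s1 c1 d1 s2 c2 d2 where
      "s1 = jacobi_sn t k" "c1 = jacobi_cn t k" "d1 = jacobi_dn t k"
      "s2 = jacobi_sn (w - t) k" "c2 = jacobi_cn (w - t) k" "d2 = jacobi_dn (w - t) k"
    note sc = this
    have rel: "c1\<^sup>2 = 1 - s1\<^sup>2" "c2\<^sup>2 = 1 - s2\<^sup>2" "d1\<^sup>2 = 1 - k\<^sup>2 * s1\<^sup>2" "d2\<^sup>2 = 1 - k\<^sup>2 * s2\<^sup>2"
      by (simp_all add: sc jacobi_cn_sq jacobi_dn_sq)
    \<comment> \<open>The derivatives of \<open>N\<close> and \<open>Q\<close> in factored form; for
      \<open>N\<close> the relations between \<open>sn\<close> and \<open>cn\<close> bring out the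
      factor that \<open>Q'\<close> has already.\<close>
    define N' where "N' = 2 * k\<^sup>2 * s1 * s2 * (d1 * c2 * s1 - c1 * d2 * s2)"
    define Q' where "Q' = 2 * k\<^sup>2 * s1 * s2 * (s1 * c2 * d2 - c1 * d1 * s2)"
    have Q0: "Q t \<noteq> 0" using k_sn_sn_less_1[of t "w - t"] by (simp add: Q_def)
    have arg: "((\<lambda>t. w - t) has_real_derivative -1) (at t)"
      by (auto intro!: derivative_eq_intros)
    note ch = DERIV_chain2[OF jacobi_sn_DERIV arg] DERIV_chain2[OF jacobi_cn_DERIV arg]
      DERIV_chain2[OF jacobi_dn_DERIV arg] jacobi_sn_DERIV jacobi_cn_DERIV jacobi_dn_DERIV
    have "(Q has_real_derivative Q') (at t)"
      unfolding Q_def[abs_def]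
      by (rule derivative_eq_intros ch refl)+
         (simp add: Q'_def algebra_simps power2_eq_square flip: sc)
    moreover have "(N has_real_derivative N') (at t)"
      unfolding N_def[abs_def]
      by (rule derivative_eq_intros ch refl)+
         (unfold sc[symmetric] N'_def, use rel(1,2) in algebra)
    ultimately have "((\<lambda>t. N t / Q t) has_real_derivative (N' * Q t - N t * Q') / (Q t * Q t)) (at t)"
      using Q0 by (intro DERIV_divide)
    moreover have "N' * Q t = N t * Q'"
      unfolding N'_def Q'_def N_def Q_def sc[symmetric] using rel by algebra
    ultimately show ?thesis by simp
  qed
  \<comment> \<open>At t = w the second argument is 0 and the quotient collapses to
    \<open>jacobi_dn w k\<close>; at t = u it is the right-hand side of the claim.\<close>
  from DERIV_isconst_all[OF allI[OF this], of u w] show ?thesis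
    by (simp add: N_def Q_def w_def jacobi_sn_def jacobi_cn_def jacobi_dn_def)
qed

section \<open>Symmetries, level sets and range of dn\<close>

lemma jacobi_sn_minus: "jacobi_sn (- u) k = - jacobi_sn u k"
  by (simp add: jacobi_sn_def jacobi_am_minus)

lemma jacobi_cn_minus: "jacobi_cn (- u) k = jacobi_cn u k"
  by (simp add: jacobi_cn_def jacobi_am_minus)

lemma jacobi_dn_minus: "jacobi_dn (- u) k = jacobi_dn u k"
  by (simp add: jacobi_dn_def jacobi_sn_minus)

text \<open>A value of \<open>dn\<close> determines exactly the squared sine of the amplitude, and a
  difference of squared sines factors into the sines of difference and sum. Thus amplitudes agree up
  to sign and multiples of pi, which \<open>ellF\<close> turns into multiples of
  \<open>2 * ellK k\<close>.\<close>

lemma jacobi_dn_eq_iff: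
  "jacobi_dn u k = jacobi_dn v k \<longleftrightarrow>
    (\<exists>j::int. v = u + 2 * ellK k * of_int j \<or> v = - u + 2 * ellK k * of_int j)"
    (is "?l \<longleftrightarrow> ?r")
proof -
  let ?x = "jacobi_am u k" and ?y = "jacobi_am v k"
  have "?l \<longleftrightarrow> (jacobi_dn u k)\<^sup>2 = (jacobi_dn v k)\<^sup>2"
    using jacobi_dn_pos[of u] jacobi_dn_pos[of v] by (simp add: power2_eq_iff_nonneg)
  also have "\<dots> \<longleftrightarrow> (sin ?y)\<^sup>2 - (sin ?x)\<^sup>2 = 0"
    using k by (auto simp: jacobi_dn_sq jacobi_sn_def)
  also have "(sin ?y)\<^sup>2 - (sin ?x)\<^sup>2 = sin (?y - ?x) * sin (?y + ?x)"
    unfolding sin_diff sin_add using sin_squared_eq[of ?x] sin_squared_eq[of ?y] by algebra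
  also have "\<dots> = 0 \<longleftrightarrow> (\<exists>j::int. ?y - ?x = of_int j * pi \<or> ?y + ?x = of_int j * pi)"
    by (auto simp: sin_zero_iff_int2)
  also have "\<dots> \<longleftrightarrow> (\<exists>j::int. ?y = ?x + of_int j * pi \<or> ?y = jacobi_am (- u) k + of_int j * pi)"
    by (simp add: jacobi_am_minus algebra_simps)
  also have "\<dots> \<longleftrightarrow> ?r"
    by (simp add: jacobi_am_eq_iff ellF_add_int_pi)
  finally show ?thesis .
qed

lemma jacobi_dn_add_period: "jacobi_dn (u + 2 * ellK k * of_int j) k = jacobi_dn u k"
  by (rule sym, subst jacobi_dn_eq_iff) blast

text \<open>Solving the relation between \<open>dn\<close> and \<open>sn\<close> for
  \<open>sn\<close> gives a number in [0, 1], which is the sine of some amplitude. This later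
  supplies the parameter of a given abscissa.\<close>

lemma jacobi_dn_surj:
  assumes "1 - k\<^sup>2 \<le> d\<^sup>2" "d \<le> 1" "0 \<le> d"
  shows "\<exists>u. jacobi_dn u k = d"
proof -
  define s where "s = sqrt (1 - d\<^sup>2) / k"
  have d1: "d\<^sup>2 \<le> 1" using assms by (simp add: power_le_one)
  have "0 \<le> s" "s\<^sup>2 = (1 - d\<^sup>2) / k\<^sup>2" using k d1 by (auto simp: s_def power_divide)
  moreover from this have "s\<^sup>2 \<le> 1" using k assms by simp
  ultimately have s: "0 \<le> s" "s \<le> 1" "k\<^sup>2 * s\<^sup>2 = 1 - d\<^sup>2"
    using k abs_square_le_1[of s] by auto
  have "jacobi_dn (ellF (arcsin s) k) k = d"
    using s assms by (simp add: jacobi_dn_def jacobi_sn_def)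
  then show ?thesis ..
qed

end

section \<open>The ovals\<close>

text \<open>The amplitude at these points is an odd multiple of \<open>pi / 2\<close>. The factor
  \<open>cos (of_int j * pi)\<close> serves as (-1)^j for integers j of either sign.\<close>

lemma jacobi_sn_half_period:
  assumes "0 < k" "k < 1" "\<epsilon> \<in> {1, -1}"
  shows "jacobi_sn (\<epsilon> * ellK k + 2 * ellK k * of_int j) k = \<epsilon> * cos (of_int j * pi)"
    and "jacobi_cn (\<epsilon> * ellK k + 2 * ellK k * of_int j) k = 0"
proof -
  have "jacobi_am (\<epsilon> * ellK k + 2 * ellK k * of_int j) k = \<epsilon> * pi / 2 + of_int j * pi"
    using assms by (auto simp: jacobi_am_add jacobi_am_minus jacobi_am_ellK)
  moreover have "sin (of_int j * pi) = 0"
    by (simp add: sin_zero_iff_int2)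
  ultimately show "jacobi_sn (\<epsilon> * ellK k + 2 * ellK k * of_int j) k = \<epsilon> * cos (of_int j * pi)"
    "jacobi_cn (\<epsilon> * ellK k + 2 * ellK k * of_int j) k = 0"
    using assms(3) by (auto simp: jacobi_sn_def jacobi_cn_def sin_add cos_add)
qed

lemma cos_int_pi_cases: "cos (of_int j * pi) \<in> {1, -1}"
  using cos_npi_int[of j] by (simp add: mult.commute)

text \<open>With positive denominators, sign and size can be read off separately. The factor
  \<open>p\<close> is 1 for abscissas and \<open>- sgn b\<close> for ordinates.\<close>

lemma signed_quotient_eq_iff:
  fixes p q d d' :: real
  assumes "\<epsilon> \<in> {1, -1}" "\<epsilon>' \<in> {1, -1}" "p \<noteq> 0" "q \<noteq> 0" "d > 0" "d' > 0"
  shows "p * \<epsilon> * q / d = p * \<epsilon>' * q / d' \<longleftrightarrow> \<epsilon> = \<epsilon>' \<and> d = d'"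
proof -
  have "p * \<epsilon> * q / d = p * \<epsilon>' * q / d' \<longleftrightarrow> p * q * (\<epsilon> * d') = p * q * (\<epsilon>' * d)"
    using assms by (simp add: frac_eq_eq mult_ac)
  also have "\<dots> \<longleftrightarrow> \<epsilon> * d' = \<epsilon>' * d"
    using assms by simp
  also have "\<dots> \<longleftrightarrow> \<epsilon> = \<epsilon>' \<and> d = d'"
    using assms by auto
  finally show ?thesis .
qed

context
  fixes k l P :: real
  assumes k: "0 < k" "k < 1"
  defines "l \<equiv> comp_modulus k" and "P \<equiv> ellK (comp_modulus k)"
begin

section \<open>Complementary modulus and values of the complex sn\<close>

lemma l_sq: "l\<^sup>2 = 1 - k\<^sup>2"
  using k by (simp add: l_def comp_modulus_def power_le_one)

lemma l_bounds: "0 < l" "l < 1"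
  using k by (auto simp: l_def comp_modulus_def power_less_one_iff)

lemma P_pos: "P > 0"
  using ellK_pos[OF l_bounds] by (simp add: P_def l_def)

lemma dn_eq_iff:
  "jacobi_dn u l = jacobi_dn v l \<longleftrightarrow>
    (\<exists>j::int. v = u + 2 * P * of_int j \<or> v = - u + 2 * P * of_int j)"
  using jacobi_dn_eq_iff[OF l_bounds] by (simp add: P_def l_def)

text \<open>Here \<open>cn (Re z)\<close> is 0 and \<open>sn (Re z)\<close> is a sign, so the value
  is real; the denominator in \<open>complex_sn\<close> becomes the square of
  \<open>dn (Im z)\<close> because \<open>k\<^sup>2 = 1 - l\<^sup>2\<close>.\<close>

lemma complex_sn_half_period:
  assumes "\<epsilon> \<in> {1, -1}" "Re z = \<epsilon> * ellK k + 2 * ellK k * of_int j"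
  shows "complex_sn z k = of_real (\<epsilon> * cos (of_int j * pi) / jacobi_dn (Im z) l)"
proof -
  define e where "e = \<epsilon> * cos (of_int j * pi)"
  have sn: "jacobi_sn (Re z) k = e" "jacobi_cn (Re z) k = 0"
    unfolding assms(2) e_def using jacobi_sn_half_period[OF k assms(1)] by simp_all
  have "e\<^sup>2 = 1"
    unfolding e_def using assms(1) cos_int_pi_cases[of j] by auto
  moreover have "(jacobi_cn (Im z) l)\<^sup>2 + k\<^sup>2 * (jacobi_sn (Im z) l)\<^sup>2 = (jacobi_dn (Im z) l)\<^sup>2"
    unfolding jacobi_cn_sq[OF l_bounds] jacobi_dn_sq[OF l_bounds] l_sq by algebra
  moreover have "Complex x 0 / of_real y = of_real (x / y)" for x y :: real
    by (simp add: complex_eq_iff)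
  ultimately have "complex_sn z k =
      of_real (e * jacobi_dn (Im z) l / (jacobi_dn (Im z) l)\<^sup>2)"
    by (simp add: complex_sn_def Let_def sn flip: l_def of_real_power of_real_mult of_real_add)
  then show ?thesis
    using jacobi_dn_pos[OF l_bounds, of "Im z"] by (simp add: e_def power2_eq_square)
qed

text \<open>Below \<open>P\<close> in absolute value, amplitudes stay strictly between
  \<open>- pi / 2\<close> and \<open>pi / 2\<close>, where arctan inverts tan. Since
  \<open>sc\<close> is tan of the amplitude, this is injectivity of \<open>sc\<close> there.\<close>

lemma tan_am_eq_iff:
  assumes "\<bar>u\<bar> < P" "\<bar>v\<bar> < P"
  shows "tan (jacobi_am u l) = tan (jacobi_am v l) \<longleftrightarrow> u = v"
proof -
  have "\<bar>jacobi_am t l\<bar> < pi / 2" if "\<bar>t\<bar> < P" for t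
    using that jacobi_am_less_iff[OF l_bounds, of t "pi / 2"]
      less_jacobi_am_iff[OF l_bounds, of "- (pi / 2)" t]
      ellF_minus[OF l_bounds, of "pi / 2"] ellF_pi_half[OF l_bounds]
    by (auto simp: P_def l_def)
  with assms have "jacobi_am u l = arctan (tan (jacobi_am u l))"
    "jacobi_am v l = arctan (tan (jacobi_am v l))"
    by (fastforce simp: arctan_tan)+
  then show ?thesis
    by (metis ellF_jacobi_am[OF l_bounds])
qed

text \<open>An imaginary value of \<open>sn\<close> forces \<open>sn (Re \<eta>) = 0\<close>.\<close>

lemma eta_cases:
  assumes "a > 0" "1 + of_real (k * a) * (complex_sn \<eta> k)\<^sup>2 = 0" "\<bar>Im \<eta>\<bar> < P"
    and "0 < \<theta>" "\<theta> < P" "jacobi_sc \<theta> l = 1 / sqrt (a * k)"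
  obtains j :: int where "Re \<eta> = 2 * ellK k * of_int j" "\<bar>Im \<eta>\<bar> = \<theta>"
proof -
  define s c d s' c' d' where
    "s = jacobi_sn (Re \<eta>) k" "c = jacobi_cn (Re \<eta>) k" "d = jacobi_dn (Re \<eta>) k"
    "s' = jacobi_sn (Im \<eta>) l" "c' = jacobi_cn (Im \<eta>) l" "d' = jacobi_dn (Im \<eta>) l"
  note sc = this
  define D where "D = c'\<^sup>2 + k\<^sup>2 * s\<^sup>2 * s'\<^sup>2"
  define p q where "p = s * d' / D" "q = c * d * s' * c' / D"
  have sn: "complex_sn \<eta> k = Complex p q"
    by (simp add: complex_sn_def Let_def p_q_def D_def complex_eq_iff flip: l_def sc)
  have pq: "1 + k * a * (p\<^sup>2 - q\<^sup>2) = 0" "p * q = 0"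
    using assms(2) k \<open>a > 0\<close> unfolding sn
    by (auto simp: complex_eq_iff power2_eq_square algebra_simps)
  have ka: "k * a > 0" using k \<open>a > 0\<close> by simp
  \<comment> \<open>A real value of \<open>sn\<close> would make
    \<open>1 + k * a * p\<^sup>2\<close> vanish, although it is positive.\<close>
  have "q \<noteq> 0"
  proof
    assume "q = 0"
    with pq ka have "1 + k * a * p\<^sup>2 = 0" by simp
    then show False using ka by (smt (verit) mult_nonneg_nonneg zero_le_power2)
  qed
  with pq have "p = 0" by simp
  \<comment> \<open>Division by zero yields 0, so a nonzero \<open>q\<close> rules out a pole; the
    same reasoning gives \<open>c' \<noteq> 0\<close> below.\<close>
  have "D \<noteq> 0" using \<open>q \<noteq> 0\<close> by (auto simp: p_q_def)
  with \<open>p = 0\<close> have s0: "s = 0"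
    using jacobi_dn_pos[OF l_bounds, of "Im \<eta>"] by (simp add: p_q_def sc)
  then obtain j :: int where "jacobi_am (Re \<eta>) k = of_int j * pi"
    by (auto simp: sc jacobi_sn_def sin_zero_iff_int2)
  then have j: "Re \<eta> = 2 * ellK k * of_int j"
    using ellF_add_int_pi[OF k, of 0 j] by (simp add: jacobi_am_eq_iff[OF k] ellF_0[OF k])
  have "c\<^sup>2 = 1" "d\<^sup>2 = 1"
    using jacobi_cn_sq[OF k, of "Re \<eta>"] jacobi_dn_sq[OF k, of "Re \<eta>"] s0 by (simp_all flip: sc)
  moreover have "c' \<noteq> 0" using \<open>q \<noteq> 0\<close> by (auto simp: p_q_def)
  moreover have "q = c * d * (s' / c')"
    using s0 \<open>c' \<noteq> 0\<close> by (simp add: p_q_def D_def power2_eq_square)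
  ultimately have "q\<^sup>2 = (s' / c')\<^sup>2"
    by (simp only: power_mult_distrib)
  moreover have "k * a * q\<^sup>2 = 1" using pq(1) \<open>p = 0\<close> by simp
  then have "q\<^sup>2 = 1 / (a * k)" using ka k \<open>a > 0\<close> by (simp add: eq_divide_eq mult_ac)
  ultimately have "(s' / c')\<^sup>2 = 1 / (a * k)" by simp
  also have "\<dots> = (1 / sqrt (a * k))\<^sup>2"
    using ka by (simp add: power_divide mult.commute)
  also have "\<dots> = (jacobi_sc \<theta> l)\<^sup>2" by (simp add: assms)
  finally have "(tan (jacobi_am (Im \<eta>) l))\<^sup>2 = (tan (jacobi_am \<theta> l))\<^sup>2"
    by (simp add: sc tan_def jacobi_sc_def jacobi_sn_def jacobi_cn_def)
  \<comment> \<open>The sign lost by squaring is absorbed into the argument, as the amplitude is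
    odd.\<close>
  then have "tan (jacobi_am (Im \<eta>) l) = tan (jacobi_am \<theta> l) \<or>
      tan (jacobi_am (Im \<eta>) l) = tan (jacobi_am (- \<theta>) l)"
    by (auto simp: power2_eq_iff jacobi_am_minus[OF l_bounds])
  then have "\<bar>Im \<eta>\<bar> = \<theta>"
    using assms by (subst (asm) (1 2) tan_am_eq_iff) auto
  with j that show ?thesis by blast
qed

text \<open>The real form of the parameterization, with \<open>v\<close> in the role of
  \<open>Im \<eta>\<close>. The sign \<open>- sgn b\<close> makes b x y negative, as the curve
  equation demands: all its other terms are nonnegative and one of them is 1.\<close>

definition oval_point :: "real \<Rightarrow> real \<Rightarrow> real \<Rightarrow> real \<Rightarrow> real \<times> real" where
  "oval_point b \<epsilon> v \<tau> =
    (\<epsilon> * sqrt k / jacobi_dn \<tau> l, - sgn b * \<epsilon> * sqrt k / jacobi_dn (\<tau> + v) l)"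

text \<open>The shift \<open>v\<close> may have either sign, to cover both
  \<open>Im \<eta> = \<theta>\<close> and \<open>Im \<eta> = - \<theta>\<close>. Assumption
  \<open>b\<close> is the definition of the modulus solved for \<open>b\<^sup>2\<close>, and
  \<open>sc_v\<close> is the squared equation for \<theta> cleared of denominators.\<close>

context
  fixes a b v :: real
  assumes a: "a > 0"
    and b: "b\<^sup>2 = a\<^sup>2 + 1 + a * (k + 1 / k)"
    and v: "0 < \<bar>v\<bar>" "\<bar>v\<bar> < P"
    and sc_v: "a * k * (jacobi_sn v l)\<^sup>2 = (jacobi_cn v l)\<^sup>2"
begin

section \<open>The ovals fill the curve\<close>

lemma b_nonzero: "b \<noteq> 0"
proof
  assume "b = 0"
  moreover have "0 < a\<^sup>2 + 1 + a * (k + 1 / k)" using a k by (simp add: add_pos_pos)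
  ultimately show False using b by simp
qed

lemma sn_v_pos: "(jacobi_sn v l)\<^sup>2 > 0"
  using sc_v jacobi_cn_sq[OF l_bounds, of v] by (cases "jacobi_sn v l = 0") auto

text \<open>Both sides are nonnegative, so squares suffice; there \<open>sc_v\<close>, as a linear
  relation for \<open>S\<close>, reduces everything to algebra. Together with \<open>sc_v\<close>
  this replaces \<open>a\<close> and \<open>b\<close> in the curve equation by Jacobi functions of
  \<open>v\<close>.\<close>

lemma abs_b: "\<bar>b\<bar> * k * (jacobi_sn v l)\<^sup>2 = jacobi_dn v l"
proof -
  define S where "S = (jacobi_sn v l)\<^sup>2"
  have S: "a * k * S = 1 - S"
    using sc_v jacobi_cn_sq[OF l_bounds, of v] by (simp add: S_def)
  have "(\<bar>b\<bar> * k * S)\<^sup>2 = b\<^sup>2 * k\<^sup>2 * S\<^sup>2" by (simp add: power_mult_distrib)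
  also have "\<dots> = (a\<^sup>2 * k\<^sup>2 + k\<^sup>2 + a * k * (k\<^sup>2 + 1)) * S\<^sup>2"
    using k unfolding b by (simp add: field_simps power2_eq_square)
  also have "\<dots> = 1 - l\<^sup>2 * S"
    using S unfolding l_sq by algebra
  also have "\<dots> = (jacobi_dn v l)\<^sup>2" by (simp add: jacobi_dn_sq[OF l_bounds] S_def)
  finally show ?thesis
    using k jacobi_dn_pos[OF l_bounds, of v]
    by (subst (asm) power2_eq_iff_nonneg) (auto simp: S_def less_imp_le)
qed

text \<open>Over a fixed abscissa the curve equation is a quadratic in \<open>\<surd>k / \<bar>y\<bar>\<close> with roots
  \<open>dn (\<tau> \<plusminus> v)\<close>; the addition theorem gives their sum and product.\<close>

lemma curve_iff_dn:
  assumes "\<epsilon> \<in> {1, -1}" "D > 0"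
  shows "(\<epsilon> * sqrt k / jacobi_dn \<tau> l, - sgn b * \<epsilon> * sqrt k / D) \<in> curve a b \<longleftrightarrow>
    D = jacobi_dn (\<tau> + v) l \<or> D = jacobi_dn (- \<tau> + v) l"
proof -
  define s c d s1 c1 d1 where
    "s = jacobi_sn v l" "c = jacobi_cn v l" "d = jacobi_dn v l"
    "s1 = jacobi_sn \<tau> l" "c1 = jacobi_cn \<tau> l" "d1 = jacobi_dn \<tau> l"
  note sc = this
  define A where "A = 1 - l\<^sup>2 * s1\<^sup>2 * s\<^sup>2"
  define d2 d3 where "d2 = jacobi_dn (\<tau> + v) l" "d3 = jacobi_dn (- \<tau> + v) l"
  have rel: "c\<^sup>2 = 1 - s\<^sup>2" "d\<^sup>2 = 1 - l\<^sup>2 * s\<^sup>2" "c1\<^sup>2 = 1 - s1\<^sup>2" "d1\<^sup>2 = 1 - l\<^sup>2 * s1\<^sup>2"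
    by (simp_all add: sc jacobi_cn_sq[OF l_bounds] jacobi_dn_sq[OF l_bounds])
  have "A > 0" using k_sn_sn_less_1[OF l_bounds] by (simp add: A_def sc)
  have d1: "d1 > 0" by (simp add: sc jacobi_dn_pos[OF l_bounds])
  have d23: "A * d2 = d1 * d - l\<^sup>2 * s1 * c1 * s * c" "A * d3 = d1 * d + l\<^sup>2 * s1 * c1 * s * c"
    using \<open>A > 0\<close> jacobi_dn_add[OF l_bounds, of "- \<tau>" v]
    by (simp_all add: d2_d3_def jacobi_dn_add[OF l_bounds, of \<tau>] jacobi_sn_minus[OF l_bounds]
        jacobi_cn_minus[OF l_bounds] jacobi_dn_minus[OF l_bounds] A_def flip: sc)
  define x y where "x = \<epsilon> * sqrt k / d1" "y = - sgn b * \<epsilon> * sqrt k / D"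
  have e: "\<epsilon>\<^sup>2 = 1" "(sgn b)\<^sup>2 = 1" using assms(1) b_nonzero by (auto simp: sgn_if)
  have x2: "x\<^sup>2 = k / d1\<^sup>2" and y2: "y\<^sup>2 = k / D\<^sup>2"
    using e k by (simp_all add: x_y_def power_divide power_mult_distrib)
  have "b * (x * y) = - (b * sgn b) * \<epsilon>\<^sup>2 * (sqrt k)\<^sup>2 / (d1 * D)"
    by (simp add: x_y_def power2_eq_square)
  also have "\<dots> = - \<bar>b\<bar> * k / (d1 * D)"
    using e k by (simp add: abs_sgn)
  finally have bxy: "b * (x * y) = - \<bar>b\<bar> * k / (d1 * D)" .
  have "d1\<^sup>2 * D\<^sup>2 * (x\<^sup>2 * y\<^sup>2 + a * (x\<^sup>2 + y\<^sup>2) + 2 * (b * (x * y)) + 1) =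
      k\<^sup>2 + a * k * (d1\<^sup>2 + D\<^sup>2) - 2 * (\<bar>b\<bar> * k) * (d1 * D) + d1\<^sup>2 * D\<^sup>2"
    unfolding x2 y2 bxy using d1 \<open>D > 0\<close> by (simp add: field_simps power2_eq_square)
  \<comment> \<open>The factor \<open>s\<^sup>2\<close> turns the coefficients with \<open>a\<close>
    and \<open>\<bar>b\<bar>\<close> into \<open>c\<^sup>2\<close> and \<open>d\<close>.\<close>
  then have "s\<^sup>2 * (d1\<^sup>2 * D\<^sup>2 * (x\<^sup>2 * y\<^sup>2 + a * (x\<^sup>2 + y\<^sup>2) + 2 * (b * (x * y)) + 1)) =
      k\<^sup>2 * s\<^sup>2 + (a * k * s\<^sup>2) * (d1\<^sup>2 + D\<^sup>2) - 2 * (\<bar>b\<bar> * k * s\<^sup>2) * (d1 * D) + s\<^sup>2 * d1\<^sup>2 * D\<^sup>2"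
    by algebra
  also have "\<dots> = k\<^sup>2 * s\<^sup>2 + c\<^sup>2 * (d1\<^sup>2 + D\<^sup>2) - 2 * d * (d1 * D) + s\<^sup>2 * d1\<^sup>2 * D\<^sup>2"
    using sc_v abs_b by (simp add: sc)
  finally have 1: "s\<^sup>2 * (d1\<^sup>2 * D\<^sup>2 * (x\<^sup>2 * y\<^sup>2 + a * (x\<^sup>2 + y\<^sup>2) + 2 * (b * (x * y)) + 1)) =
      k\<^sup>2 * s\<^sup>2 + c\<^sup>2 * (d1\<^sup>2 + D\<^sup>2) - 2 * d * (d1 * D) + s\<^sup>2 * d1\<^sup>2 * D\<^sup>2" .
  have 2: "A * (k\<^sup>2 * s\<^sup>2 + c\<^sup>2 * (d1\<^sup>2 + D\<^sup>2) - 2 * d * (d1 * D) + s\<^sup>2 * d1\<^sup>2 * D\<^sup>2) =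
      (A * D - A * d2) * (A * D - A * d3)"
  proof -
    \<comment> \<open>The leading coefficient of the quadratic in \<open>D\<close> is
      \<open>A\<close> itself; the next equation compares the constant term with the product of the
      roots.\<close>
    have "A = c\<^sup>2 + s\<^sup>2 * d1\<^sup>2"
      unfolding A_def rel by algebra
    moreover have "A * (k\<^sup>2 * s\<^sup>2 + c\<^sup>2 * d1\<^sup>2) = d1\<^sup>2 * d\<^sup>2 - (l\<^sup>2)\<^sup>2 * s1\<^sup>2 * c1\<^sup>2 * s\<^sup>2 * c\<^sup>2"
      unfolding A_def rel l_sq by algebra
    ultimately show ?thesis
      unfolding d23 by algebra
  qed
  have "(x, y) \<in> curve a b \<longleftrightarrow> x\<^sup>2 * y\<^sup>2 + a * (x\<^sup>2 + y\<^sup>2) + 2 * (b * (x * y)) + 1 = 0"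
    by (simp add: curve_def algebra_simps)
  also have "\<dots> \<longleftrightarrow> k\<^sup>2 * s\<^sup>2 + c\<^sup>2 * (d1\<^sup>2 + D\<^sup>2) - 2 * d * (d1 * D) + s\<^sup>2 * d1\<^sup>2 * D\<^sup>2 = 0"
    unfolding 1[symmetric] using d1 assms(2) sn_v_pos by (simp add: sc)
  also have "\<dots> \<longleftrightarrow> D = d2 \<or> D = d3"
    using 2 \<open>A > 0\<close> by (metis (no_types, opaque_lifting) eq_iff_diff_eq_0 less_irrefl mult_cancel_left mult_eq_0_iff)
  finally show ?thesis by (simp add: x_y_def d2_d3_def sc)
qed

lemma oval_point_in_curve: "\<epsilon> \<in> {1, -1} \<Longrightarrow> oval_point b \<epsilon> v \<tau> \<in> curve a b"
  unfolding oval_point_def by (subst curve_iff_dn) (auto simp: jacobi_dn_pos[OF l_bounds])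

text \<open>Real solvability for y confines \<open>x\<^sup>2\<close> to [k, 1/k], which is the range
  of \<open>k / dn\<^sup>2\<close>, so some parameter t has the right abscissa. Of the two ordinates
  allowed by \<open>curve_iff_dn\<close>, one belongs to t and the other to -t.\<close>

lemma curve_cases:
  assumes "M \<in> curve a b"
  obtains \<epsilon> \<tau> where "\<epsilon> \<in> {1, -1}" "M = oval_point b \<epsilon> v \<tau>"
proof -
  obtain x y where M: "M = (x, y)" by force
  have eq: "x\<^sup>2 * y\<^sup>2 + a * (x\<^sup>2 + y\<^sup>2) + 2 * b * x * y + 1 = 0"
    using assms by (simp add: M curve_def)
  moreover have "x\<^sup>2 * y\<^sup>2 + a * (x\<^sup>2 + y\<^sup>2) \<ge> 0" using a by simp
  ultimately have bxy: "b * (x * y) < 0" by (simp add: mult.assoc)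
  then have nz: "x \<noteq> 0" "y \<noteq> 0" by auto
  have sg: "sgn y = - sgn b * sgn x"
    using bxy by (auto simp: sgn_if mult_less_0_iff zero_less_mult_iff)
  \<comment> \<open>Completing the square in y leaves a quarter of the discriminant, whose zeros in
    \<open>x\<^sup>2\<close> are k and 1/k by the choice of the modulus.\<close>
  have "((x\<^sup>2 + a) * y + b * x)\<^sup>2 = b\<^sup>2 * x\<^sup>2 - (x\<^sup>2 + a) * (a * x\<^sup>2 + 1)"
    using eq by algebra
  also have "\<dots> = - a * ((x\<^sup>2 - k) * (x\<^sup>2 - 1 / k))"
    using k unfolding b by (simp add: field_simps power2_eq_square)
  finally have "a * ((x\<^sup>2 - k) * (x\<^sup>2 - 1 / k)) \<le> 0"
    by (smt (verit) mult_minus_left zero_le_power2)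
  then have le: "(x\<^sup>2 - k) * (x\<^sup>2 - 1 / k) \<le> 0"
    using a by (simp add: mult_le_0_iff)
  have "k < 1 / k" using k by (simp add: field_simps) (smt (verit) mult_less_cancel_left2)
  with le have x2: "k \<le> x\<^sup>2" "x\<^sup>2 \<le> 1 / k"
    by (auto simp: mult_le_0_iff)
  define D1 D2 where "D1 = sqrt k / \<bar>x\<bar>" "D2 = sqrt k / \<bar>y\<bar>"
  have D2: "D2 > 0" using nz k by (simp add: D1_D2_def)
  have D1_sq: "D1\<^sup>2 = k / x\<^sup>2" using k by (simp add: D1_D2_def power_divide)
  have "D1\<^sup>2 \<le> 1" using x2 nz by (simp add: D1_sq)
  then have "D1 \<le> 1" by (simp add: abs_square_le_1)
  moreover have "1 - l\<^sup>2 \<le> D1\<^sup>2"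
    unfolding D1_sq l_sq using x2 nz k by (simp add: field_simps power2_eq_square)
  moreover have "0 \<le> D1" using k by (simp add: D1_D2_def)
  ultimately obtain t where t: "jacobi_dn t l = D1"
    using jacobi_dn_surj[OF l_bounds] by blast
  have e: "sgn x \<in> {1, -1}" using nz by (auto simp: sgn_if)
  have x: "x = sgn x * sqrt k / D1" and y: "y = - sgn b * sgn x * sqrt k / D2"
    unfolding sg[symmetric] using k nz by (auto simp: D1_D2_def mult_sgn_abs)
  have "D2 = jacobi_dn (t + v) l \<or> D2 = jacobi_dn (- t + v) l"
    using assms curve_iff_dn[OF e D2, of t] unfolding M t using x y by metis
  then have "M = oval_point b (sgn x) v t \<or> M = oval_point b (sgn x) v (- t)"
    unfolding M oval_point_def jacobi_dn_minus[OF l_bounds] t using x y by metis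
  with that e show ?thesis by blast
qed

section \<open>Injectivity of the parameterization modulo its period\<close>

lemma fst_oval_point_eq_iff:
  assumes "\<epsilon> \<in> {1, -1}" "\<epsilon>' \<in> {1, -1}"
  shows "fst (oval_point b \<epsilon> v \<tau>) = fst (oval_point b \<epsilon>' v \<tau>') \<longleftrightarrow>
    \<epsilon> = \<epsilon>' \<and> jacobi_dn \<tau> l = jacobi_dn \<tau>' l"
  using signed_quotient_eq_iff[OF assms, of 1 "sqrt k"] k jacobi_dn_pos[OF l_bounds]
  by (simp add: oval_point_def)

lemma snd_oval_point_eq_iff:
  assumes "\<epsilon> \<in> {1, -1}" "\<epsilon>' \<in> {1, -1}"
  shows "snd (oval_point b \<epsilon> v \<tau>) = snd (oval_point b \<epsilon>' v \<tau>') \<longleftrightarrow>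
    \<epsilon> = \<epsilon>' \<and> jacobi_dn (\<tau> + v) l = jacobi_dn (\<tau>' + v) l"
  unfolding oval_point_def snd_conv
  by (rule signed_quotient_eq_iff[OF assms])
     (use k b_nonzero jacobi_dn_pos[OF l_bounds] in \<open>auto simp: sgn_zero_iff\<close>)

lemma oval_point_add_period:
  "oval_point b \<epsilon> v (t + 2 * P * of_int j) = oval_point b \<epsilon> v t"
proof -
  have *: "jacobi_dn (u + 2 * P * of_int j) l = jacobi_dn u l" for u
    using jacobi_dn_add_period[OF l_bounds] by (simp add: P_def l_def)
  have "t + 2 * P * of_int j + v = t + v + 2 * P * of_int j" by simp
  then show ?thesis
    unfolding oval_point_def by (simp only: *)
qed

text \<open>The two coordinates determine \<open>\<tau>\<close> up to sign and \<open>\<tau> + v\<close> up to sign, so the only danger is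
  \<open>2v \<in> 2K'\<int>\<close>, excluded by \<open>0 < \<bar>v\<bar> < K'\<close>.\<close>

lemma oval_point_eq_iff:
  assumes "\<epsilon> \<in> {1, -1}" "\<epsilon>' \<in> {1, -1}"
  shows "oval_point b \<epsilon> v t = oval_point b \<epsilon>' v t' \<longleftrightarrow>
    \<epsilon> = \<epsilon>' \<and> (\<exists>j::int. t' = t + 2 * P * of_int j)"
proof
  assume eq: "oval_point b \<epsilon> v t = oval_point b \<epsilon>' v t'"
  then have e: "\<epsilon> = \<epsilon>'"
    and "jacobi_dn t l = jacobi_dn t' l" "jacobi_dn (t + v) l = jacobi_dn (t' + v) l"
    using fst_oval_point_eq_iff[OF assms, of t t'] snd_oval_point_eq_iff[OF assms, of t t'] by simp_all
  then obtain i j :: int where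
    i: "t' = t + 2 * P * of_int i \<or> t' = - t + 2 * P * of_int i" and
    j: "t' + v = t + v + 2 * P * of_int j \<or> t' + v = - (t + v) + 2 * P * of_int j"
    unfolding dn_eq_iff by blast
  have False if "t' = - t + 2 * P * of_int i" "t' + v = - (t + v) + 2 * P * of_int j"
  proof -
    have "v = P * of_int (j - i)" using that by (simp add: algebra_simps)
    then have "\<bar>v\<bar> = P * of_int \<bar>j - i\<bar>" using P_pos by (simp add: abs_mult)
    then have "0 < real_of_int \<bar>j - i\<bar>" "real_of_int \<bar>j - i\<bar> < 1"
      using v P_pos by (simp_all add: zero_less_mult_iff del: of_int_abs)
    then show False by simp
  qed
  then show "\<epsilon> = \<epsilon>' \<and> (\<exists>j::int. t' = t + 2 * P * of_int j)"
    using i j e by auto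
qed (elim conjE exE, simp only: oval_point_add_period)

section \<open>The switches and the John mapping in terms of the parameter\<close>

lemma vertical_switch_oval_point:
  assumes "\<epsilon> \<in> {1, -1}"
  shows "vertical_switch (curve a b) (oval_point b \<epsilon> v \<tau>) = oval_point b \<epsilon> v (- \<tau>)"
proof -
  let ?M = "oval_point b \<epsilon> v \<tau>" and ?N = "oval_point b \<epsilon> v (- \<tau>)"
  have *: "N = ?M \<or> N = ?N" if N: "N \<in> curve a b" "fst N = fst ?M" for N
  proof -
    obtain \<epsilon>' t where t: "\<epsilon>' \<in> {1, -1}" "N = oval_point b \<epsilon>' v t" using curve_cases[OF N(1)] .
    then have e: "\<epsilon>' = \<epsilon>" and "jacobi_dn \<tau> l = jacobi_dn t l"
      using N(2) fst_oval_point_eq_iff[OF t(1) assms, of t \<tau>] by simp_all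
    then obtain j :: int where
      "t = \<tau> + 2 * P * of_int j \<or> t = - \<tau> + 2 * P * of_int j"
      unfolding dn_eq_iff by blast
    then show ?thesis
      unfolding t(2) e by (elim disjE) (simp_all only: oval_point_add_period simp_thms)
  qed
  have "?N \<in> curve a b" using assms by (rule oval_point_in_curve)
  moreover have "fst ?N = fst ?M" by (simp add: oval_point_def jacobi_dn_minus[OF l_bounds])
  \<comment> \<open>If \<open>?N\<close> and \<open>?M\<close> coincide, the line meets the curve
    only in \<open>?M\<close>, and the switch returns that point.\<close>
  ultimately show ?thesis
    unfolding vertical_switch_def by (auto dest: * intro!: the_equality)
qed

lemma horizontal_switch_oval_point:
  assumes "\<epsilon> \<in> {1, -1}"
  shows "horizontal_switch (curve a b) (oval_point b \<epsilon> v \<tau>) = oval_point b \<epsilon> v (- \<tau> - 2 * v)"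
proof -
  let ?M = "oval_point b \<epsilon> v \<tau>" and ?N = "oval_point b \<epsilon> v (- \<tau> - 2 * v)"
  have *: "N = ?M \<or> N = ?N" if N: "N \<in> curve a b" "snd N = snd ?M" for N
  proof -
    obtain \<epsilon>' t where t: "\<epsilon>' \<in> {1, -1}" "N = oval_point b \<epsilon>' v t" using curve_cases[OF N(1)] .
    then have e: "\<epsilon>' = \<epsilon>" and "jacobi_dn (\<tau> + v) l = jacobi_dn (t + v) l"
      using N(2) snd_oval_point_eq_iff[OF t(1) assms, of t \<tau>] by simp_all
    then obtain j :: int where
      "t + v = \<tau> + v + 2 * P * of_int j \<or> t + v = - (\<tau> + v) + 2 * P * of_int j"
      unfolding dn_eq_iff by blast
    then have "t = \<tau> + 2 * P * of_int j \<or> t = (- \<tau> - 2 * v) + 2 * P * of_int j" by auto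
    then show ?thesis
      unfolding t(2) e by (elim disjE) (simp_all only: oval_point_add_period simp_thms)
  qed
  \<comment> \<open>The reflection in -v negates \<tau> + v, the argument of the even function
    \<open>dn\<close> in the ordinate.\<close>
  have "- \<tau> - 2 * v + v = - (\<tau> + v)" by simp
  then have "snd ?N = snd ?M"
    unfolding oval_point_def snd_conv by (simp only: jacobi_dn_minus[OF l_bounds])
  moreover have "?N \<in> curve a b" using assms by (rule oval_point_in_curve)
  ultimately show ?thesis
    unfolding horizontal_switch_def by (auto dest: * intro!: the_equality)
qed

lemma john_map_oval_point:
  "\<epsilon> \<in> {1, -1} \<Longrightarrow> john_map (curve a b) (oval_point b \<epsilon> v \<tau>) = oval_point b \<epsilon> v (\<tau> - 2 * v)"
  by (simp add: john_map_def vertical_switch_oval_point horizontal_switch_oval_point)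

lemma john_map_funpow_oval_point:
  assumes "\<epsilon> \<in> {1, -1}"
  shows "(john_map (curve a b) ^^ n) (oval_point b \<epsilon> v \<tau>) = oval_point b \<epsilon> v (\<tau> - 2 * real n * v)"
  by (induction n) (use assms in \<open>simp_all add: john_map_oval_point algebra_simps\<close>)

text \<open>The n-th iterate shifts the parameter by -2nv, which has to be a multiple of
  \<open>2 * P\<close>. The criterion is independent of \<open>M\<close>; hence all points share one
  minimal period.\<close>

lemma john_map_funpow_fixed_iff:
  assumes "M \<in> curve a b"
  shows "(john_map (curve a b) ^^ n) M = M \<longleftrightarrow> real n * v / P \<in> \<int>"
proof -
  obtain \<epsilon> \<tau> where M: "\<epsilon> \<in> {1, -1}" "M = oval_point b \<epsilon> v \<tau>" using curve_cases[OF assms] .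
  have "(john_map (curve a b) ^^ n) M = M \<longleftrightarrow> (\<exists>j::int. \<tau> = \<tau> - 2 * real n * v + 2 * P * of_int j)"
    unfolding M(2) john_map_funpow_oval_point[OF M(1)] oval_point_eq_iff[OF M(1) M(1)] by simp
  also have "\<dots> \<longleftrightarrow> (\<exists>j::int. real n * v / P = of_int j)"
    using P_pos by (auto simp: field_simps)
  finally show ?thesis by (simp add: Ints_def image_iff)
qed

section \<open>Counting turns\<close>

lemma travel_oval_point:
  assumes "\<epsilon> \<in> {1, -1}"
  shows "travel (oval_point b \<epsilon> v) (- sgn v) (john_map (curve a b)) (oval_point b \<epsilon> v \<tau>) = 2 * \<bar>v\<bar>"
proof -
  have P: "P > 0" by (rule P_pos)
  let ?S = "{d. d \<ge> 0 \<and> (\<exists>t. oval_point b \<epsilon> v t = oval_point b \<epsilon> v \<tau> \<and>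
      oval_point b \<epsilon> v (t + - sgn v * d) = oval_point b \<epsilon> v (\<tau> - 2 * v))}"
  have "2 * \<bar>v\<bar> \<in> ?S"
    by (auto intro!: exI[of _ \<tau>] arg_cong[where f = "oval_point b \<epsilon> v"] simp: sgn_if)
  moreover have "2 * \<bar>v\<bar> \<le> d" if d: "d \<in> ?S" for d
  proof -
    obtain t where t: "d \<ge> 0" "oval_point b \<epsilon> v t = oval_point b \<epsilon> v \<tau>"
      "oval_point b \<epsilon> v (t + - sgn v * d) = oval_point b \<epsilon> v (\<tau> - 2 * v)" using d by blast
    then obtain i j :: int where ij: "\<tau> = t + 2 * P * of_int i"
      "\<tau> - 2 * v = t + - sgn v * d + 2 * P * of_int j"
      unfolding oval_point_eq_iff[OF assms assms] by blast
    then have *: "sgn v * d = 2 * v + 2 * P * of_int (j - i)"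
      by (simp add: algebra_simps)
    \<comment> \<open>The number of extra full turns, counted in the direction of motion.\<close>
    define n where "n = (if v > 0 then j - i else i - j)"
    have dn: "d = 2 * \<bar>v\<bar> + 2 * P * of_int n"
      using * v by (auto simp: n_def sgn_if algebra_simps split: if_splits)
    \<comment> \<open>One turn less would already make \<open>d\<close> negative, since
      \<open>\<bar>v\<bar> < P\<close>.\<close>
    have "n \<ge> 0"
    proof (rule ccontr)
      assume "\<not> n \<ge> 0"
      then have "real_of_int n \<le> -1" by linarith
      then have "P * of_int n \<le> P * (-1)" using P by (intro mult_left_mono) auto
      then show False using dn t(1) v by linarith
    qed
    then show ?thesis using dn P by simp
  qed
  ultimately show ?thesis
    unfolding travel_def john_map_oval_point[OF assms] by (intro cInf_eq_minimum)
qed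

lemma turns_oval_point:
  assumes "\<epsilon> \<in> {1, -1}"
  shows "turns (oval_point b \<epsilon> v) (2 * P) (- sgn v) (john_map (curve a b)) n (oval_point b \<epsilon> v \<tau>)
    = real n * \<bar>v\<bar> / P"
  using P_pos
  by (simp add: turns_def john_map_funpow_oval_point[OF assms] travel_oval_point[OF assms])

section \<open>Agreement of the complex and the real parameterization\<close>

lemma oval_param_eq_oval_point:
  assumes "oval_param a b k \<epsilon> \<eta> \<gamma>" "Im \<eta> = v" "Re \<eta> = 2 * ellK k * of_int j"
  shows "\<gamma> = oval_point b \<epsilon> v"
proof
  fix \<tau>
  have e: "\<epsilon> \<in> {1, -1}" using assms(1) by (simp add: oval_param_def)
  \<comment> \<open>The sign (-1)^j by which the real shift \<open>2 * ellK k * of_int j\<close>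
    multiplies \<open>sn\<close>.\<close>
  define \<delta> where "\<delta> = cos (of_int j * pi)"
  have d: "\<delta> \<in> {1, -1}" unfolding \<delta>_def by (rule cos_int_pi_cases)
  have C: "\<gamma> \<tau> \<in> curve a b" using assms(1) by (simp add: oval_param_def)
  have "complex_of_real (fst (\<gamma> \<tau>)) = of_real (\<epsilon> * sqrt k / jacobi_dn \<tau> l)"
    using assms(1) complex_sn_half_period[OF e, of "of_real (\<epsilon> * ellK k) + \<i> * of_real \<tau>" 0]
    by (simp add: oval_param_def)
  then have x: "fst (\<gamma> \<tau>) = \<epsilon> * sqrt k / jacobi_dn \<tau> l" by (simp only: of_real_eq_iff)
  have "complex_of_real (snd (\<gamma> \<tau>)) = of_real (\<delta> * \<epsilon> * sqrt k / jacobi_dn (\<tau> + v) l)"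
    using assms complex_sn_half_period[OF e, of "of_real (\<epsilon> * ellK k) + \<i> * of_real \<tau> + \<eta>" j]
    by (simp add: oval_param_def \<delta>_def mult_ac)
  then have y: "snd (\<gamma> \<tau>) = \<delta> * \<epsilon> * sqrt k / jacobi_dn (\<tau> + v) l" by (simp only: of_real_eq_iff)
  \<comment> \<open>Membership in the curve forces b x y to be negative, and this selects
    \<delta>.\<close>
  have "(fst (\<gamma> \<tau>))\<^sup>2 * (snd (\<gamma> \<tau>))\<^sup>2 + a * ((fst (\<gamma> \<tau>))\<^sup>2 + (snd (\<gamma> \<tau>))\<^sup>2) \<ge> 0"
    using a by simp
  then have "b * (fst (\<gamma> \<tau>) * snd (\<gamma> \<tau>)) < 0"
    using C by (auto simp: curve_def split_beta mult.assoc)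
  also have "b * (fst (\<gamma> \<tau>) * snd (\<gamma> \<tau>)) =
      b * \<delta> * (k / (jacobi_dn \<tau> l * jacobi_dn (\<tau> + v) l))"
    unfolding x y using e k by auto
  finally have "b * \<delta> < 0"
    using k jacobi_dn_pos[OF l_bounds, of \<tau>] jacobi_dn_pos[OF l_bounds, of "\<tau> + v"]
    by (smt (verit) divide_pos_pos mult_nonneg_nonneg mult_pos_pos)
  then have "\<delta> = - sgn b" using d by (auto simp: sgn_if)
  then show "\<gamma> \<tau> = oval_point b \<epsilon> v \<tau>"
    using x y by (simp add: oval_point_def prod_eq_iff)
qed

text \<open>A purely imaginary \<eta> gives coordinates of equal sign, right for negative
  \<open>b\<close>; for positive \<open>b\<close> the summand \<open>2 * ellK k\<close> reverses the
  sign of y.\<close>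

lemma oval_param_oval_point:
  assumes "\<epsilon> \<in> {1, -1}"
  shows "oval_param a b k \<epsilon> (Complex (if b < 0 then 0 else 2 * ellK k) v) (oval_point b \<epsilon> v)"
proof -
  define j :: int where "j = (if b < 0 then 0 else 1)"
  define \<eta> where "\<eta> = Complex (if b < 0 then 0 else 2 * ellK k) v"
  have Re: "Re \<eta> = 2 * ellK k * of_int j" and Im: "Im \<eta> = v" by (auto simp: \<eta>_def j_def)
  have \<delta>: "cos (of_int j * pi) = - sgn b" using b_nonzero by (auto simp: j_def sgn_if)
  have am: "jacobi_am (Re \<eta>) k = of_int j * pi"
    using jacobi_am_add[OF k, of 0 j] by (simp add: Re jacobi_am_0[OF k])
  have "jacobi_sn (Re \<eta>) k = 0" "jacobi_cn (Re \<eta>) k = - sgn b"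
    by (simp_all add: jacobi_sn_def jacobi_cn_def am \<delta> sin_zero_iff_int2)
  then have "complex_sn \<eta> k =
      Complex 0 (- sgn b * jacobi_sn v l * jacobi_cn v l) / of_real ((jacobi_cn v l)\<^sup>2)"
    by (simp add: complex_sn_def Let_def Im jacobi_dn_def l_def)
  also have "\<dots> = Complex 0 (- sgn b * jacobi_sn v l / jacobi_cn v l)"
    by (simp add: complex_eq_iff power2_eq_square)
  finally have "(complex_sn \<eta> k)\<^sup>2 = of_real (- ((sgn b)\<^sup>2 * (jacobi_sn v l)\<^sup>2 / (jacobi_cn v l)\<^sup>2))"
    by (simp add: complex_eq_iff power2_eq_square)
  also have "(sgn b)\<^sup>2 = 1" using b_nonzero by (auto simp: sgn_if)
  also have "- (1 * (jacobi_sn v l)\<^sup>2 / (jacobi_cn v l)\<^sup>2) = - 1 / (k * a)"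
    unfolding sc_v[symmetric] using sn_v_pos a k by (simp add: field_simps)
  finally have "1 + of_real (k * a) * (complex_sn \<eta> k)\<^sup>2 = 1 + of_real (k * a * (- 1 / (k * a)))"
    by (simp only: of_real_mult)
  also have "k * a * (- 1 / (k * a)) = - 1" using a k by simp
  finally have eta: "1 + of_real (k * a) * (complex_sn \<eta> k)\<^sup>2 = 0" by simp
  show ?thesis
    unfolding oval_param_def \<eta>_def[symmetric] Im
  proof (intro conjI allI)
    fix \<tau>
    show "complex_of_real (fst (oval_point b \<epsilon> v \<tau>)) =
        of_real (sqrt k) * complex_sn (of_real (\<epsilon> * ellK k) + \<i> * of_real \<tau>) k"
      by (subst complex_sn_half_period[OF assms, of _ 0]) (simp_all add: oval_point_def)
    show "complex_of_real (snd (oval_point b \<epsilon> v \<tau>)) =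
        of_real (sqrt k) * complex_sn (of_real (\<epsilon> * ellK k) + \<i> * of_real \<tau> + \<eta>) k"
      by (subst complex_sn_half_period[OF assms, of _ j, unfolded \<delta>])
         (simp_all add: oval_point_def Re Im mult_ac)
  qed (use assms v eta oval_point_in_curve in \<open>auto simp: P_def\<close>)
qed

end

text \<open>The explicit solution \<open>ellF (arctan (1 / sqrt (a * k))) l\<close> is positive and
  lies below \<open>P\<close> because arctan stays below \<open>pi / 2\<close>; minimality places
  \<theta> at or below it.\<close>

lemma theta_bounds:
  assumes "a > 0" "\<theta> > 0" "jacobi_sc \<theta> l = 1 / sqrt (a * k)"
    and min: "\<And>t. t > 0 \<Longrightarrow> jacobi_sc t l = 1 / sqrt (a * k) \<Longrightarrow> \<theta> \<le> t"
  shows "\<theta> < P" and "a * k * (jacobi_sn \<theta> l)\<^sup>2 = (jacobi_cn \<theta> l)\<^sup>2"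
proof -
  have ak: "a * k > 0" using k assms by simp
  define t where "t = ellF (arctan (1 / sqrt (a * k))) l"
  have "jacobi_sc t l = tan (arctan (1 / sqrt (a * k)))"
    by (simp add: t_def jacobi_sc_def jacobi_sn_def jacobi_cn_def jacobi_am_ellF[OF l_bounds] tan_def)
  moreover have "t > 0"
    using strict_monoD[OF ellF_strict_mono[OF l_bounds], of 0 "arctan (1 / sqrt (a * k))"] ak
    by (simp add: t_def ellF_0[OF l_bounds])
  ultimately have "\<theta> \<le> t" by (intro min) (simp_all add: tan_arctan)
  also have "t < ellF (pi / 2) l"
    unfolding t_def by (rule strict_monoD[OF ellF_strict_mono[OF l_bounds]]) (rule arctan_ubound)
  finally show "\<theta> < P" using ellF_pi_half[OF l_bounds] by (simp add: P_def l_def)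
  have "jacobi_sn \<theta> l / jacobi_cn \<theta> l = 1 / sqrt (a * k)"
    using assms(3) by (simp add: jacobi_sc_def)
  \<comment> \<open>A quotient with denominator 0 would be 0, but the right-hand side is
    positive.\<close>
  moreover from this have "jacobi_cn \<theta> l \<noteq> 0" using ak by auto
  ultimately have "sqrt (a * k) * jacobi_sn \<theta> l = jacobi_cn \<theta> l"
    using ak assms(1) k by (simp add: field_simps)
  then have "(jacobi_cn \<theta> l)\<^sup>2 = (sqrt (a * k))\<^sup>2 * (jacobi_sn \<theta> l)\<^sup>2"
    by (metis power_mult_distrib)
  then show "a * k * (jacobi_sn \<theta> l)\<^sup>2 = (jacobi_cn \<theta> l)\<^sup>2" using ak by simp
qed

end

section \<open>Rational rotation numbers\<close>

lemma real_mult_quotient_in_Ints_iff: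
  fixes m n i :: nat
  assumes "n > 0" "coprime m n"
  shows "real i * (real m / real n) \<in> \<int> \<longleftrightarrow> n dvd i"
proof
  assume "real i * (real m / real n) \<in> \<int>"
  then obtain z :: int where "real i * (real m / real n) = of_int z" by (auto elim: Ints_cases)
  then have "real_of_int (int i * int m) = real_of_int (z * int n)"
    using assms by (simp add: field_simps)
  then have "int i * int m = z * int n" by (simp only: of_int_eq_iff)
  then have "int n dvd int (i * m)" by simp
  then have "n dvd i * m" by (simp only: int_dvd_int_iff)
  then show "n dvd i" using assms by (simp add: coprime_commute coprime_dvd_mult_left_iff)
next
  assume "n dvd i"
  then obtain q where "i = n * q" ..
  then have "real i * (real m / real n) = of_nat (q * m)" using assms by simp
  then show "real i * (real m / real n) \<in> \<int>" by (simp only: Ints_of_nat)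
qed

theorem proposition18:
  fixes a b k \<theta> :: real
  defines "C \<equiv> curve a b"
    and "T \<equiv> john_map (curve a b)"
    and "k' \<equiv> comp_modulus k"
    and "K' \<equiv> ellK (comp_modulus k)"
  assumes "a > 0" and "b\<^sup>2 > (a + 1)\<^sup>2"
    and "0 < k" and "k < 1" and "k + 1 / k = (b\<^sup>2 - a\<^sup>2 - 1) / a"
    and "\<theta> > 0" and "jacobi_sc \<theta> k' = 1 / sqrt (a * k)"
    and "\<And>t. t > 0 \<Longrightarrow> jacobi_sc t k' = 1 / sqrt (a * k) \<Longrightarrow> \<theta> \<le> t"
  shows "((\<exists>M\<in>C. periodic_point T M) \<longleftrightarrow> \<theta> / K' \<in> \<rat>) \<and>
    (\<forall>m n :: nat. n > 0 \<and> coprime m n \<and> \<theta> / K' = real m / real n \<longrightarrow>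
       (\<forall>M\<in>C. periodic_point T M \<and> min_period T M = n \<and>
          (\<exists>\<epsilon> \<eta> \<gamma>. oval_param a b k \<epsilon> \<eta> \<gamma> \<and> M \<in> range \<gamma>) \<and>
          (\<forall>\<epsilon> \<eta> \<gamma>. oval_param a b k \<epsilon> \<eta> \<gamma> \<and> M \<in> range \<gamma> \<longrightarrow>
             john_turns a b k \<eta> \<gamma> n M = real m)))"
proof -
  note k = \<open>0 < k\<close> \<open>k < 1\<close>
  have b: "b\<^sup>2 = a\<^sup>2 + 1 + a * (k + 1 / k)" using assms(5,9) by simp
  have \<theta>: "\<theta> < K'" "a * k * (jacobi_sn \<theta> k')\<^sup>2 = (jacobi_cn \<theta> k')\<^sup>2"
    unfolding K'_def k'_def
    using theta_bounds[OF k \<open>a > 0\<close> \<open>\<theta> > 0\<close>] assms(11,12) unfolding k'_def by blast+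
  have K': "K' > 0" using P_pos[OF k] by (simp add: K'_def)
  have abs_th: "0 < \<bar>\<theta>\<bar>" "\<bar>\<theta>\<bar> < ellK (comp_modulus k)"
    using \<theta>(1) \<open>\<theta> > 0\<close> by (simp_all add: K'_def)
  note th = k \<open>a > 0\<close> b abs_th \<theta>(2)[unfolded k'_def]
  have fixed: "(T ^^ n) M = M \<longleftrightarrow> real n * (\<theta> / K') \<in> \<int>" if "M \<in> C" for n M
    using john_map_funpow_fixed_iff[OF th] that by (simp add: C_def T_def K'_def)
  \<comment> \<open>A witness that the curve is nonempty, for the direction from rationality to a
    periodic point.\<close>
  have "oval_point k b 1 \<theta> 0 \<in> C" using oval_point_in_curve[OF th] by (simp add: C_def)
  show ?thesis
  proof (intro conjI allI impI ballI)
    show "(\<exists>M\<in>C. periodic_point T M) \<longleftrightarrow> \<theta> / K' \<in> \<rat>"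
    proof
      assume "\<exists>M\<in>C. periodic_point T M"
      then obtain n :: nat where n: "n \<ge> 1" "real n * (\<theta> / K') \<in> \<int>"
        unfolding periodic_point_def using fixed by blast
      then have "real n * (\<theta> / K') / real n \<in> \<rat>"
        using Ints_subset_Rats by (intro Rats_divide) auto
      then show "\<theta> / K' \<in> \<rat>" using n(1) by simp
    next
      assume "\<theta> / K' \<in> \<rat>"
      moreover have "\<theta> / K' > 0" using \<open>\<theta> > 0\<close> K' by simp
      ultimately obtain m n :: nat where "n \<noteq> 0" "\<bar>\<theta> / K'\<bar> = real m / real n"
        using Rats_abs_nat_div_natE by metis
      then have "n \<ge> 1" "real n * (\<theta> / K') = of_nat m"
        using \<open>\<theta> / K' > 0\<close> unfolding abs_of_pos[OF \<open>\<theta> / K' > 0\<close>] by auto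
      then show "\<exists>M\<in>C. periodic_point T M"
        unfolding periodic_point_def using fixed \<open>oval_point k b 1 \<theta> 0 \<in> C\<close> Ints_of_nat by metis
    qed
  next
    fix m n :: nat and M
    assume mn: "0 < n \<and> coprime m n \<and> \<theta> / K' = real m / real n" and M: "M \<in> C"
    have iff: "(T ^^ i) M = M \<longleftrightarrow> n dvd i" for i
      using fixed[OF M] real_mult_quotient_in_Ints_iff mn by simp
    show "periodic_point T M"
      unfolding periodic_point_def using iff mn by (metis One_nat_def Suc_leI dvd_refl)
    show "min_period T M = n"
      unfolding min_period_def iff by (rule Least_equality) (use mn in \<open>auto dest: dvd_imp_le\<close>)
    obtain \<epsilon> \<tau> where "\<epsilon> \<in> {1, -1}" "M = oval_point k b \<epsilon> \<theta> \<tau>"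
      using curve_cases[OF th] M by (metis C_def)
    then show "\<exists>\<epsilon> \<eta> \<gamma>. oval_param a b k \<epsilon> \<eta> \<gamma> \<and> M \<in> range \<gamma>"
      using oval_param_oval_point[OF th] by blast
    fix \<epsilon> \<eta> \<gamma>
    assume *: "oval_param a b k \<epsilon> \<eta> \<gamma> \<and> M \<in> range \<gamma>"
    then obtain j :: int where eta: "Re \<eta> = 2 * ellK k * of_int j" "\<bar>Im \<eta>\<bar> = \<theta>"
      using eta_cases[OF k \<open>a > 0\<close>, of \<eta> \<theta>] \<theta>(1) \<open>\<theta> > 0\<close> assms(11)
      unfolding oval_param_def K'_def k'_def by metis
    \<comment> \<open>The given parameterization may have \<open>Im \<eta> = - \<theta>\<close>. The
      results on ovals are therefore instantiated again, with \<open>v = Im \<eta>\<close>, so that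
      the turns are counted along \<gamma> itself.\<close>
    have "a * k * (jacobi_sn (Im \<eta>) k')\<^sup>2 = (jacobi_cn (Im \<eta>) k')\<^sup>2"
      using eta(2) \<theta>(2) jacobi_sn_minus[OF l_bounds[OF k], of \<theta>]
        jacobi_cn_minus[OF l_bounds[OF k], of \<theta>]
      by (auto simp: k'_def abs_if split: if_splits)
    then have th': "0 < \<bar>Im \<eta>\<bar>" "\<bar>Im \<eta>\<bar> < ellK (comp_modulus k)"
      "a * k * (jacobi_sn (Im \<eta>) (comp_modulus k))\<^sup>2 = (jacobi_cn (Im \<eta>) (comp_modulus k))\<^sup>2"
      using abs_th eta(2) by (auto simp: k'_def)
    note th' = k \<open>a > 0\<close> b th'
    have e: "\<epsilon> \<in> {1, -1}" using * by (simp add: oval_param_def)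
    have \<gamma>: "\<gamma> = oval_point k b \<epsilon> (Im \<eta>)"
      using oval_param_eq_oval_point[OF th'] * eta(1) by blast
    with * obtain \<tau> where "M = oval_point k b \<epsilon> (Im \<eta>) \<tau>" by blast
    then have "john_turns a b k \<eta> \<gamma> n M = real n * (\<theta> / K')"
      unfolding john_turns_def \<gamma> using turns_oval_point[OF th' e] eta(2) by (simp add: K'_def)
    then show "john_turns a b k \<eta> \<gamma> n M = real m" using mn by simp
  qed
qed

end
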